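(* Let $n\ge 1$. A word $w$ over $[n]$ fixes all $n$-component increasing networks if and only if $w$ is $n$-complete. Hence $\lambda_I(n)=\lambda(n)$.
   Context: An $n$-component (Boolean) network is a function $f=(f_1,\dots,f_n):\{0,1\}^n\to\{0,1\}^n$. Write $[n]=\{1,\dots,n\}$. The network $f$ is increasing if $x\le f(x)$ (componentwise) for all $x\in\{0,1\}^n$. For $i\in[n]$, $f^i(x):=(x_1,\dots,x_{i-1},f_i(x),x_{i+1},\dots,x_n)$, and for a word $w=i_1\dots i_k$ over $[n]$, $f^w:=f^{i_k}\circ\cdots\circ f^{i_1}$ (identity for the empty word). A word $w$ fixes $f$ if $f^w(x)$ is a fixed point of $f$ for every $x$. $\lambda_I(n)$ is the minimum length of a single word fixing all $n$-component increasing networks. A word is $n$-complete if it contains every permutation of $[n]$ (viewed as a word using each letter once) as a (not necessarily contiguous) subsequence; $\lambda(n)$ is the length of a shortest $n$-complete word. *)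

theory Defs
  imports
    "HOL-Library.FuncSet"
    "HOL-Library.Sublist"
    "HOL-Combinatorics.Multiset_Permutations"
begin

text \<open>
  A point of \<open>{0,1}\<^sup>n\<close> is an extensional function on \<open>{1..n}\<close>, with \<open>False < True\<close> playing
  the role of \<open>0 < 1\<close>. Extensionality makes equality of configurations (and hence being a
  fixed point) coincide with componentwise equality on \<open>{1..n}\<close>.
\<close>

type_synonym config = "nat \<Rightarrow> bool"

definition configs :: "nat \<Rightarrow> config set" where
  "configs n = {1..n} \<rightarrow>\<^sub>E UNIV"

definition networks :: "nat \<Rightarrow> (config \<Rightarrow> config) set" where
  "networks n = configs n \<rightarrow> configs n"

definition increasing :: "nat \<Rightarrow> (config \<Rightarrow> config) \<Rightarrow> bool" where
  "increasing n f \<longleftrightarrow> (\<forall>x\<in>configs n. \<forall>i\<in>{1..n}. x i \<le> f x i)"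

definition update :: "(config \<Rightarrow> config) \<Rightarrow> nat \<Rightarrow> config \<Rightarrow> config" where
  "update f i x = x(i := f x i)"

text \<open>\<open>fold\<close> applies the update of the first letter first.\<close>

definition update_word :: "(config \<Rightarrow> config) \<Rightarrow> nat list \<Rightarrow> config \<Rightarrow> config" where
  "update_word f w = fold (update f) w"

definition word_fixes :: "nat \<Rightarrow> nat list \<Rightarrow> (config \<Rightarrow> config) \<Rightarrow> bool" where
  "word_fixes n w f \<longleftrightarrow> (\<forall>x\<in>configs n. f (update_word f w x) = update_word f w x)"

definition fixes_all_increasing :: "nat \<Rightarrow> nat list \<Rightarrow> bool" where
  "fixes_all_increasing n w \<longleftrightarrow> (\<forall>f\<in>networks n. increasing n f \<longrightarrow> word_fixes n w f)"

definition complete_word :: "nat \<Rightarrow> nat list \<Rightarrow> bool" where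
  "complete_word n w \<longleftrightarrow> (\<forall>p\<in>permutations_of_set {1..n}. subseq p w)"

definition lambda_I :: "nat \<Rightarrow> nat" where
  "lambda_I n = (LEAST k. \<exists>w\<in>lists {1..n}. length w = k \<and> fixes_all_increasing n w)"

definition lambda :: "nat \<Rightarrow> nat" where
  "lambda n = (LEAST k. \<exists>w\<in>lists {1..n}. length w = k \<and> complete_word n w)"

text \<open>The minimum defining \<^const>\<open>lambda\<close> ranges over a nonempty set.\<close>

lemma subseq_concat_replicate:
  "set p \<subseteq> set xs \<Longrightarrow> subseq p (concat (replicate (length p) xs))"
proof (induction p)
  case (Cons a p)
  then have "subseq [a] xs" by (simp add: subseq_singleton_left)
  moreover have "subseq p (concat (replicate (length p) xs))"
    using Cons by simp
  ultimately have "subseq ([a] @ p) (xs @ concat (replicate (length p) xs))"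
    by (rule list_emb_append_mono)
  then show ?case by simp
qed simp

lemma complete_word_exists: "\<exists>w\<in>lists {1..n}. complete_word n w"
proof
  let ?w = "concat (replicate n [1..<Suc n])"
  show "complete_word n ?w"
    unfolding complete_word_def
  proof
    fix p assume "p \<in> permutations_of_set {1..n}"
    then have "set p = {1..n}" "length p = n"
      by (auto simp: permutations_of_set_def dest: distinct_card)
    moreover from this have "set p \<subseteq> set [1..<Suc n]"
      by (simp only: set_upt) auto
    ultimately show "subseq p ?w"
      using subseq_concat_replicate[of p "[1..<Suc n]"] by simp
  qed
  show "?w \<in> lists {1..n}" by auto
qed

end

theory Submission
  imports Defs
begin

text \<open>
  The components that change along \<open>w\<close>, listed in the order of their changes and followed by a
  component that is still unstable at the end, form a word that is not a subsequence of \<open>w\<close>: any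
  embedding of it in \<open>w\<close> would lag behind the changes themselves. Changes of an increasing network
  happen once per component, so this word extends to a permutation. Conversely, the network that
  switches the components on in the order of a permutation \<open>p\<close> is driven from \<open>0\<close> to a fixed
  point by \<open>w\<close> only if \<open>p\<close> is a subsequence of \<open>w\<close>.
\<close>

lemma update_word_Nil [simp]: "update_word f [] x = x"
  by (simp add: update_word_def)

lemma update_word_Cons [simp]: "update_word f (a # w) x = update_word f w (update f a x)"
  by (simp add: update_word_def)

lemma update_in_configs:
  "x \<in> configs n \<Longrightarrow> a \<in> {1..n} \<Longrightarrow> update f a x \<in> configs n"
  by (auto simp: configs_def update_def PiE_iff extensional_def)

lemma update_word_in_configs:
  "x \<in> configs n \<Longrightarrow> set w \<subseteq> {1..n} \<Longrightarrow> update_word f w x \<in> configs n"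
  by (induction w arbitrary: x) (simp_all add: update_in_configs)

lemma update_mono:
  assumes "increasing n f" "x \<in> configs n" "a \<in> {1..n}" "x j"
  shows "update f a x j"
  using assms by (auto simp: increasing_def update_def)

lemma update_word_mono:
  assumes "increasing n f" "x \<in> configs n" "set w \<subseteq> {1..n}" "x j"
  shows "update_word f w x j"
  using assms(2-4)
  by (induction w arbitrary: x) (simp_all add: update_in_configs update_mono[OF assms(1)])

text \<open>
  The clause on the head makes the induction on \<open>w\<close> go through: a letter that changes nothing
  cannot be the first one of \<open>q @ [i]\<close>.
\<close>

lemma change_order_not_subseq:
  assumes incr: "increasing n f"
    and "x \<in> configs n" "set w \<subseteq> {1..n}"
    and "f (update_word f w x) i \<noteq> update_word f w x i"
  shows "\<exists>q. distinct q \<and> set q \<subseteq> {j\<in>{1..n}. \<not> x j \<and> update_word f w x j}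
    \<and> f x (hd (q @ [i])) \<noteq> x (hd (q @ [i])) \<and> \<not> subseq (q @ [i]) w"
  using assms(2-4)
proof (induction w arbitrary: x)
  case Nil
  then show ?case by (intro exI[of _ "[]"]) auto
next
  case (Cons a w)
  let ?x = "update f a x"
  have a: "a \<in> {1..n}" and w: "set w \<subseteq> {1..n}" using Cons.prems by auto
  have x': "?x \<in> configs n" using Cons.prems(1) a by (rule update_in_configs)
  from Cons.IH[OF x' w] Cons.prems(3)
  obtain q where q: "distinct q" "set q \<subseteq> {j\<in>{1..n}. \<not> ?x j \<and> update_word f w ?x j}"
    "f ?x (hd (q @ [i])) \<noteq> ?x (hd (q @ [i]))" "\<not> subseq (q @ [i]) w"
    by auto
  show ?case
  proof (cases "f x a = x a")
    case True
    then have eq: "?x = x" by (simp add: update_def)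
    with q(3) True have "hd (q @ [i]) \<noteq> a" by auto
    with q(4) have "\<not> subseq (q @ [i]) (a # w)"
      by (cases q) auto
    with q eq show ?thesis by (intro exI[of _ q]) simp
  next
    case False
    then have off: "\<not> x a" and on: "?x a"
      using incr Cons.prems(1) a by (auto simp: increasing_def update_def)
    have "update_word f w ?x a"
      using update_word_mono[OF incr x' w] on .
    moreover have "a \<notin> set q" using q(2) on by auto
    moreover have "\<not> x j" if "j \<in> set q" for j
      using q(2) that update_mono[OF incr Cons.prems(1) a] by auto
    \<comment> \<open>The changing letter \<open>a\<close> goes in front of \<open>q\<close>:
      matching it uses up the first letter of \<open>a # w\<close>, and \<open>q @ [i]\<close> would
      have to embed in \<open>w\<close>. Since \<open>a\<close> is on in \<open>?x\<close>, it is
      not among the letters of \<open>q\<close>.\<close>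
    ultimately show ?thesis
      using q a off False by (intro exI[of _ "a # q"]) auto
  qed
qed

lemma distinct_extend_to_permutation:
  assumes "finite A" "distinct q" "set q \<subseteq> A"
  obtains r where "q @ r \<in> permutations_of_set A"
proof -
  obtain r where "set r = A - set q" "distinct r"
    using assms(1) finite_distinct_list by (metis finite_Diff)
  with assms have "q @ r \<in> permutations_of_set A"
    by (auto simp: permutations_of_set_def)
  then show thesis by (rule that)
qed

lemma complete_imp_fixes_all_increasing:
  assumes w: "set w \<subseteq> {1..n}" and complete: "complete_word n w"
  shows "fixes_all_increasing n w"
  unfolding fixes_all_increasing_def word_fixes_def
proof (intro ballI impI)
  fix f x
  assume f: "f \<in> networks n" and incr: "increasing n f" and x: "x \<in> configs n"
  let ?y = "update_word f w x"
  have y: "?y \<in> configs n" using x w by (rule update_word_in_configs)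
  with f have fy: "f ?y \<in> configs n" by (auto simp: networks_def)
  show "f ?y = ?y"
  proof (rule ccontr)
    assume "f ?y \<noteq> ?y"
    then obtain i where i: "i \<in> {1..n}" "f ?y i \<noteq> ?y i"
      using PiE_ext[OF fy[unfolded configs_def] y[unfolded configs_def]] by blast
    \<comment> \<open>In an increasing network an unstable component is off, while the letters of
      \<open>q\<close> will be on in \<open>?y\<close>; so \<open>i\<close> cannot repeat one of
      them.\<close>
    with incr y have off: "\<not> ?y i" by (auto simp: increasing_def)
    obtain q where q: "distinct q" "set q \<subseteq> {j\<in>{1..n}. \<not> x j \<and> ?y j}"
      "\<not> subseq (q @ [i]) w"
      using change_order_not_subseq[OF incr x w i(2)] by blast
    with off i(1) have "distinct (q @ [i])" "set (q @ [i]) \<subseteq> {1..n}" by auto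
    then obtain r where "(q @ [i]) @ r \<in> permutations_of_set {1..n}"
      using distinct_extend_to_permutation by blast
    with complete have "subseq ((q @ [i]) @ r) w"
      unfolding complete_word_def by blast
    then have "subseq (q @ [i]) w"
      by (meson list_emb_append_mono prefixI prefix_imp_subseq subseq_order.trans)
    with q(3) show False by contradiction
  qed
qed

definition indicator_config :: "nat \<Rightarrow> nat list \<Rightarrow> config" where
  "indicator_config n u = (\<lambda>i\<in>{1..n}. i \<in> set u)"

text \<open>For a permutation \<open>p\<close> the dynamics is a single chain from 0 to 1: the
  unstable configurations are the indicators of the proper prefixes of \<open>p\<close>, each with
  the next letter of \<open>p\<close> as its only unstable component.\<close>

definition chain_network :: "nat \<Rightarrow> nat list \<Rightarrow> config \<Rightarrow> config" where
  "chain_network n p x =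
    (\<lambda>i\<in>{1..n}. x i \<or> (\<exists>u v. p = u @ i # v \<and> x = indicator_config n u))"

lemma indicator_config_in_configs: "indicator_config n u \<in> configs n"
  by (simp add: indicator_config_def configs_def)

lemma chain_network_in_networks: "chain_network n p \<in> networks n"
  by (auto simp: chain_network_def networks_def configs_def)

lemma increasing_chain_network: "increasing n (chain_network n p)"
  by (auto simp: chain_network_def increasing_def)

lemma indicator_config_inj:
  assumes "indicator_config n u = indicator_config n u'" "set u \<subseteq> {1..n}" "set u' \<subseteq> {1..n}"
  shows "set u = set u'"
proof -
  have "i \<in> set u \<longleftrightarrow> i \<in> set u'" if "i \<in> {1..n}" for i
    using fun_cong[OF assms(1), of i] that by (simp add: indicator_config_def)
  with assms(2,3) show ?thesis by blast
qed

text \<open>A configuration records only the set of letters of a prefix. Prefixes of a word without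
  repetition that have the same set have the same length, hence are equal, so the split of
  \<open>p\<close> in \<open>chain_network\<close> can only be the one at \<open>u\<close>.\<close>

lemma chain_network_indicator:
  assumes p: "u @ v \<in> permutations_of_set {1..n}" and i: "i \<in> {1..n}"
  shows "chain_network n (u @ v) (indicator_config n u) i
    \<longleftrightarrow> i \<in> set u \<or> (\<exists>v'. v = i # v')"
proof -
  have d: "distinct (u @ v)" and s: "set u \<union> set v = {1..n}"
    using p by (auto simp: permutations_of_set_def)
  have "u' = u" if "u @ v = u' @ i # v'" "indicator_config n u = indicator_config n u'" for u' v'
  proof -
    have "set u' \<subseteq> {1..n}" using s arg_cong[OF that(1), of set] by auto
    then have "set u = set u'" using indicator_config_inj[OF that(2)] s by auto
    moreover have "distinct u" "distinct u'" using d that(1) by (auto dest: arg_cong[of _ _ distinct])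
    ultimately have "length u = length u'" by (metis distinct_card)
    with that(1) show "u' = u" by simp
  qed
  then show ?thesis
    using i by (auto simp: chain_network_def indicator_config_def)
qed

text \<open>Reading \<open>w\<close> matches \<open>v\<close> greedily: a letter acts exactly when
  it is the next one awaited, and \<open>v1\<close> collects the letters matched.\<close>

lemma update_word_chain_network:
  assumes "u @ v \<in> permutations_of_set {1..n}" "set w \<subseteq> {1..n}"
  shows "\<exists>v1 v2. v = v1 @ v2 \<and> subseq v1 w \<and>
    update_word (chain_network n (u @ v)) w (indicator_config n u) = indicator_config n (u @ v1)"
  using assms
proof (induction w arbitrary: u v)
  case Nil
  then show ?case by (intro exI[of _ "[]"] exI[of _ v]) simp
next
  case (Cons a w)
  let ?f = "chain_network n (u @ v)"
  have a: "a \<in> {1..n}" and w: "set w \<subseteq> {1..n}" using Cons.prems(2) by auto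
  note step = chain_network_indicator[OF Cons.prems(1) a]
  show ?case
  proof (cases "\<exists>v'. v = a # v'")
    case True
    then obtain v' where v: "v = a # v'" by blast
    have "update ?f a (indicator_config n u) = indicator_config n (u @ [a])"
      using step v a by (auto simp: update_def indicator_config_def fun_eq_iff)
    moreover obtain v1 v2 where "v' = v1 @ v2" "subseq v1 w"
      "update_word ?f w (indicator_config n (u @ [a])) = indicator_config n (u @ a # v1)"
      \<comment> \<open>Moving \<open>a\<close> from \<open>v\<close> to \<open>u\<close> leaves
        \<open>u @ v\<close>, and with it the network, unchanged.\<close>
      using Cons.IH[of "u @ [a]" v'] Cons.prems(1) w v by auto
    ultimately show ?thesis
      using v by (intro exI[of _ "a # v1"] exI[of _ v2]) simp
  next
    case False
    then have "update ?f a (indicator_config n u) = indicator_config n u"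
      using step a by (auto simp: update_def indicator_config_def fun_eq_iff)
    with Cons.IH[OF Cons.prems(1) w] obtain v1 v2 where "v = v1 @ v2" "subseq v1 w"
      "update_word ?f (a # w) (indicator_config n u) = indicator_config n (u @ v1)"
      by auto
    then show ?thesis by (blast intro: list_emb_Cons)
  qed
qed

lemma fixes_all_increasing_imp_complete:
  assumes w: "set w \<subseteq> {1..n}" and "fixes_all_increasing n w"
  shows "complete_word n w"
  unfolding complete_word_def
proof
  fix p assume p: "p \<in> permutations_of_set {1..n}"
  let ?f = "chain_network n p"
  obtain u v where uv: "p = u @ v" "subseq u w"
    and reach: "update_word ?f w (indicator_config n []) = indicator_config n u"
    using update_word_chain_network[of "[]" p n w] p w by auto
  have "word_fixes n w ?f"
    using assms(2) chain_network_in_networks increasing_chain_network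
    unfolding fixes_all_increasing_def by blast
  then have fixed: "?f (indicator_config n u) = indicator_config n u"
    unfolding word_fixes_def using reach indicator_config_in_configs by metis
  \<comment> \<open>If letters of \<open>p\<close> were left over, the first of them would be
    unstable at the configuration reached.\<close>
  have "v = []"
  proof (cases v)
    case (Cons a v')
    with p uv have a: "a \<in> {1..n}" "a \<notin> set u" by (auto simp: permutations_of_set_def)
    have "?f (indicator_config n u) a"
      using chain_network_indicator[of u v n a] p uv a Cons by simp
    with fixed a show ?thesis by (simp add: indicator_config_def)
  qed
  with uv show "subseq p w" by simp
qed

theorem proposition3:
  fixes n :: nat
  assumes "n \<ge> 1"
  shows "(\<forall>w\<in>lists {1..n}. fixes_all_increasing n w \<longleftrightarrow> complete_word n w)
       \<and> lambda_I n = lambda n"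
proof
  show iff: "\<forall>w\<in>lists {1..n}. fixes_all_increasing n w \<longleftrightarrow> complete_word n w"
    using complete_imp_fixes_all_increasing fixes_all_increasing_imp_complete
    by (auto simp: in_lists_conv_set subset_iff)
  \<comment> \<open>Both minima range over words in \<open>lists {1..n}\<close>, where the two
    predicates agree.\<close>
  then show "lambda_I n = lambda n"
    unfolding lambda_I_def lambda_def by (intro arg_cong[of _ _ Least] ext bex_cong refl) simp
qed

end
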